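(* The game of tic-tac-toe played on the affine plane of order $4$, $\pi_4$, is a first player win: the first player has a strategy that guarantees that he is the first to occupy all points of some line, regardless of how the second player plays.
   Context: An affine plane of order $n$ is a set of $n^2$ points together with $n(n+1)$ lines, each line a set of $n$ points, such that any two distinct points lie on exactly one common line; the lines partition into $n+1$ parallel classes, each partitioning the point set. The affine plane of order $4$, $\pi_4$ (16 points, 20 lines of 4 points each, 5 parallel classes), is unique up to isomorphism. Tic-tac-toe on $\pi_4$: two players alternately choose previously unchosen points, the first player moving first; a player wins as soon as he or she has chosen all points of some line; if all points are chosen without a win the game is a draw. *)

theory Defs
  imports Main "HOL-Library.Disjoint_Sets"
begin

definition affine_plane :: "nat \<Rightarrow> 'a set \<Rightarrow> 'a set set \<Rightarrow> bool" where
  "affine_plane n P L \<longleftrightarrow>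
     finite P \<and> card P = n\<^sup>2 \<and>
     finite L \<and> card L = n * (n + 1) \<and>
     (\<forall>l\<in>L. l \<subseteq> P \<and> card l = n) \<and>
     (\<forall>p\<in>P. \<forall>q\<in>P. p \<noteq> q \<longrightarrow> (\<exists>!l. l \<in> L \<and> p \<in> l \<and> q \<in> l)) \<and>
     (\<exists>C. partition_on L C \<and> card C = n + 1 \<and> (\<forall>c\<in>C. partition_on P c))"

text \<open>
  A history lists the chosen points in the order in which they were chosen. Indices start at 0,
  so the first player owns the entries at even indices and the second player those at odd indices.
\<close>

definition first_points :: "'a list \<Rightarrow> 'a set" where
  "first_points h = {h ! i | i. i < length h \<and> even i}"

definition second_points :: "'a list \<Rightarrow> 'a set" where
  "second_points h = {h ! i | i. i < length h \<and> odd i}"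

definition occupies_line :: "'a set set \<Rightarrow> 'a set \<Rightarrow> bool" where
  "occupies_line L S \<longleftrightarrow> (\<exists>l\<in>L. l \<subseteq> S)"

definition game_over :: "'a set \<Rightarrow> 'a set set \<Rightarrow> 'a list \<Rightarrow> bool" where
  "game_over P L h \<longleftrightarrow>
     occupies_line L (first_points h) \<or> occupies_line L (second_points h) \<or> set h = P"

inductive history :: "'a set \<Rightarrow> 'a set set \<Rightarrow> 'a list \<Rightarrow> bool" for P L where
  start: "history P L []"
| move: "history P L h \<Longrightarrow> \<not> game_over P L h \<Longrightarrow> p \<in> P - set h \<Longrightarrow> history P L (h @ [p])"

definition follows :: "('a list \<Rightarrow> 'a) \<Rightarrow> 'a list \<Rightarrow> bool" where
  "follows \<sigma> h \<longleftrightarrow> (\<forall>i<length h. even i \<longrightarrow> h ! i = \<sigma> (take i h))"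

text \<open>
  A history cannot be continued once a line is occupied. Hence a finished game in which the first
  player occupies a line is one in which he is the first to do so, and the second player occupies
  none. The clause on \<open>P - set h\<close> makes the strategy prescribe a legal move whenever the
  first player is to move. Every play ends after at most \<open>card P\<close> moves.
\<close>

definition first_winning_strategy ::
    "'a set \<Rightarrow> 'a set set \<Rightarrow> ('a list \<Rightarrow> 'a) \<Rightarrow> bool" where
  "first_winning_strategy P L \<sigma> \<longleftrightarrow>
     (\<forall>h. history P L h \<and> follows \<sigma> h \<longrightarrow>
        (\<not> game_over P L h \<and> even (length h) \<longrightarrow> \<sigma> h \<in> P - set h) \<and>
        (game_over P L h \<longrightarrow> occupies_line L (first_points h)))"

definition first_player_win :: "'a set \<Rightarrow> 'a set set \<Rightarrow> bool" where
  "first_player_win P L \<longleftrightarrow> (\<exists>\<sigma>. first_winning_strategy P L \<sigma>)"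

text \<open>
  The plane over the field with four elements; the point \<open>(x, y)\<close> is encoded as
  \<open>4 * x + y\<close>, with field elements numbered so that addition is bitwise exclusive or.
\<close>

definition plane4_classes :: "nat set list list" where
  "plane4_classes =
    [[{0,1,2,3}, {4,5,6,7}, {8,9,10,11}, {12,13,14,15}],
     [{0,4,8,12}, {1,5,9,13}, {2,6,10,14}, {3,7,11,15}],
     [{0,5,10,15}, {1,4,11,14}, {2,7,8,13}, {3,6,9,12}],
     [{0,6,11,13}, {1,7,10,12}, {2,4,9,15}, {3,5,8,14}],
     [{0,7,9,14}, {1,6,8,15}, {2,5,11,12}, {3,4,10,13}]]"

lemma affine_plane_4_exists:
  "affine_plane 4 (set [0..<16]) (set (concat plane4_classes))"
proof -
  let ?P = "set [0..<16]" and ?L = "set (concat plane4_classes)"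
    and ?C = "set (map set plane4_classes)"
  have len: "card ?P = 16" "card ?L = 20" by code_simp+
  have lines: "\<forall>l\<in>?L. l \<subseteq> ?P \<and> card l = 4" by code_simp
  have ex: "\<forall>p\<in>?P. \<forall>q\<in>?P. p \<noteq> q \<longrightarrow> (\<exists>l\<in>?L. p \<in> l \<and> q \<in> l)" by code_simp
  have un: "\<forall>l\<in>?L. \<forall>m\<in>?L. l \<noteq> m \<longrightarrow> card (l \<inter> m) \<le> 1" by code_simp
  have uniq: "\<exists>!l. l \<in> ?L \<and> p \<in> l \<and> q \<in> l"
    if pq: "p \<in> ?P" "q \<in> ?P" "p \<noteq> q" for p q
  proof -
    obtain l where l: "l \<in> ?L" "p \<in> l" "q \<in> l" using ex pq by blast
    have "m = l" if m: "m \<in> ?L" "p \<in> m" "q \<in> m" for m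
    proof (rule ccontr)
      assume "m \<noteq> l"
      then have le: "card (m \<inter> l) \<le> 1" using un m(1) l(1) by blast
      have "finite (m \<inter> l)" using lines l(1) by (meson List.finite_set finite_Int finite_subset)
      then have "card {p, q} \<le> card (m \<inter> l)" using l m by (intro card_mono) auto
      then show False using le pq(3) by simp
    qed
    then show ?thesis using l by blast
  qed
  have cov: "\<Union> ?C = ?L" by (auto simp: plane4_classes_def)
  have cc: "card ?C = 5" "{} \<notin> ?C" by code_simp+
  have dC: "\<forall>c\<in>?C. \<forall>d\<in>?C. c \<noteq> d \<longrightarrow> c \<inter> d = {}" by code_simp
  have part: "\<forall>c\<in>?C. \<Union> c = ?P \<and> {} \<notin> c \<and> (\<forall>l\<in>c. \<forall>m\<in>c. l \<noteq> m \<longrightarrow> l \<inter> m = {})"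
    by code_simp
  have "partition_on ?L ?C"
    using cov cc(2) dC by (intro partition_onI) (auto simp: disjnt_def)
  moreover have "partition_on ?P c" if "c \<in> ?C" for c
    using bspec[OF part that] unfolding partition_on_def disjoint_def by blast
  ultimately have "\<exists>C. partition_on ?L C \<and> card C = 4 + 1 \<and> (\<forall>c\<in>C. partition_on ?P c)"
    using cc(1) by (intro exI[of _ ?C] conjI ballI) simp_all
  then show ?thesis
    unfolding affine_plane_def using len lines uniq
    by (intro conjI ballI impI) (simp_all only: List.finite_set, simp_all)
qed

end

theory Submission
  imports Defs
begin

text \<open>
  Let \<open>p\<close> be any opening move and \<open>q\<close> the reply. Two parallel classes, the first being that of the
  line \<open>p q\<close>, together with a line of a third class through \<open>p\<close> put coordinates on the plane for
  which \<open>p\<close> has number 0 and \<open>q\<close> number 1. Each of the other 11 lines is then determined by two of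
  its points and the condition that it meets the rows, the columns and the diagonal at most once.
  So it is enough to win on one explicit plane after the opening 0, 1, and there a tree of 418 moves,
  most of them threats that leave a single reply, suffices.
\<close>

section \<open>Positional wins\<close>

text \<open>
  In \<open>wins P L A B\<close> the first player owns \<open>A\<close>, the second player owns \<open>B\<close>, and the first player
  is to move.
\<close>

inductive wins :: "'a set \<Rightarrow> 'a set set \<Rightarrow> 'a set \<Rightarrow> 'a set \<Rightarrow> bool" for P L where
  finish: "p \<in> P - (A \<union> B) \<Longrightarrow> occupies_line L (insert p A) \<Longrightarrow> wins P L A B"
| step: "p \<in> P - (A \<union> B) \<Longrightarrow> P \<noteq> insert p (A \<union> B) \<Longrightarrow>
    (\<And>q. q \<in> P - insert p (A \<union> B) \<Longrightarrow>
       \<not> occupies_line L (insert q B) \<and> wins P L (insert p A) (insert q B)) \<Longrightarrow> wins P L A B"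

section \<open>Growth of the players' point sets along a history\<close>

text \<open>Stated for an arbitrary predicate \<open>Q\<close> on indices so that it serves both
  players, with \<open>Q\<close> as \<open>even\<close> and as \<open>odd\<close>.\<close>

lemma nth_image_append:
  "{(h @ [p]) ! i | i. i < length (h @ [p]) \<and> Q i} =
    (if Q (length h) then insert p {h ! i | i. i < length h \<and> Q i} else {h ! i | i. i < length h \<and> Q i})"
proof -
  have "{(h @ [p]) ! i | i. i < length (h @ [p]) \<and> Q i} = (!) (h @ [p]) ` {i. i < Suc (length h) \<and> Q i}"
    by auto
  also have "{i. i < Suc (length h) \<and> Q i} =
      {i. i < length h \<and> Q i} \<union> (if Q (length h) then {length h} else {})"
    by (auto simp: less_Suc_eq)
  also have "(!) (h @ [p]) ` \<dots> =
      (!) (h @ [p]) ` {i. i < length h \<and> Q i} \<union> (if Q (length h) then {p} else {})"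
    by (auto simp: image_Un)
  also have "(!) (h @ [p]) ` {i. i < length h \<and> Q i} = (!) h ` {i. i < length h \<and> Q i}"
    by (intro image_cong) (auto simp: nth_append)
  also have "\<dots> = {h ! i | i. i < length h \<and> Q i}" by blast
  finally show ?thesis by simp
qed

lemma first_points_append:
  "first_points (h @ [p]) = (if even (length h) then insert p (first_points h) else first_points h)"
  unfolding first_points_def by (rule nth_image_append)

lemma second_points_append:
  "second_points (h @ [p]) = (if odd (length h) then insert p (second_points h) else second_points h)"
  unfolding second_points_def by (rule nth_image_append)

lemma set_eq_first_Un_second: "set h = first_points h \<union> second_points h"
  unfolding first_points_def second_points_def set_conv_nth by blast

lemma follows_append:
  "follows \<sigma> (h @ [p]) \<longleftrightarrow> follows \<sigma> h \<and> (even (length h) \<longrightarrow> p = \<sigma> h)"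
  unfolding follows_def by (auto simp: nth_append less_Suc_eq)

section \<open>From winning positions to a winning strategy\<close>

text \<open>The premises of the two rules of \<open>wins\<close>, read off a history, so that a
  strategy can choose a witness. The clause \<open>P \<noteq> insert p (set h)\<close> keeps a draw
  on a full board from passing as a win, since the quantification over replies would then be
  vacuous.\<close>

definition good_move :: "'a set \<Rightarrow> 'a set set \<Rightarrow> 'a list \<Rightarrow> 'a \<Rightarrow> bool" where
  "good_move P L h p \<longleftrightarrow> p \<in> P - set h \<and>
     (occupies_line L (insert p (first_points h)) \<or>
      P \<noteq> insert p (set h) \<and>
      (\<forall>q \<in> P - insert p (set h). \<not> occupies_line L (insert q (second_points h)) \<and>
         wins P L (insert p (first_points h)) (insert q (second_points h))))"

lemma wins_imp_good_move:
  "wins P L (first_points h) (second_points h) \<Longrightarrow> \<exists>p. good_move P L h p"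
  unfolding good_move_def set_eq_first_Un_second by (erule wins.cases) blast+

text \<open>Both rules pick a free point. Thus a won position with the first player to move is never
  a full board, which excludes a draw after a move of the second player.\<close>

lemma wins_imp_free_point: "wins P L A B \<Longrightarrow> P \<noteq> A \<union> B"
  by (erule wins.cases) auto

text \<open>The strategy picks any good move. Along every play that follows it, the position stays
  won whenever the first player is to move, so the play can only end with his line.\<close>

lemma first_player_win_if_wins:
  assumes "wins P L {} {}" and "{} \<notin> L"
  shows "first_player_win P L"
proof -
  define \<sigma> where "\<sigma> h = (SOME p. good_move P L h p)" for h
  have \<sigma>: "good_move P L h (\<sigma> h)" if "wins P L (first_points h) (second_points h)" for h
    unfolding \<sigma>_def using wins_imp_good_move[OF that] by (rule someI_ex)
  \<comment> \<open>The invariant has one branch for finished games and one for each player to move.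
    The last branch is what a good move that does not end the game leaves behind.\<close>
  have inv: "if game_over P L h then occupies_line L (first_points h)
      else if even (length h) then wins P L (first_points h) (second_points h)
      else \<forall>q \<in> P - set h. \<not> occupies_line L (insert q (second_points h)) \<and>
        wins P L (first_points h) (insert q (second_points h))"
    if "history P L h" "follows \<sigma> h" for h
    using that
  proof (induction rule: history.induct)
    case start
    have "first_points [] = {}" "second_points [] = {}"
      by (auto simp: first_points_def second_points_def)
    moreover have "P \<noteq> {}" using wins_imp_free_point[OF assms(1)] by simp
    ultimately show ?case
      using assms by (auto simp: game_over_def occupies_line_def)
  next
    case (move h p)
    \<comment> \<open>A history is extended only while the game is not over, so the first branch of
      the invariant drops out for \<open>h\<close>.\<close>
    note IH = move.IH[unfolded if_not_P[OF move.hyps(2)]]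
    have foll: "follows \<sigma> h" using move.prems by (simp add: follows_append)
    show ?case
    proof (cases "even (length h)")
      case True
      then have "good_move P L h p"
        using \<sigma>[of h] IH[OF foll] move.prems by (simp add: follows_append)
      then show ?thesis
        using True move.hyps(2)
        by (auto simp: good_move_def game_over_def first_points_append second_points_append)
    next
      case False
      then have *: "\<not> occupies_line L (insert p (second_points h))"
        "wins P L (first_points h) (insert p (second_points h))"
        using IH[OF foll] move.hyps(3) by auto
      moreover have "insert p (set h) \<noteq> P"
        using wins_imp_free_point[OF *(2)] by (auto simp: set_eq_first_Un_second)
      ultimately show ?thesis
        using False move.hyps(2)
        by (auto simp: game_over_def first_points_append second_points_append)
    qed
  qed
  have "first_winning_strategy P L \<sigma>"
    unfolding first_winning_strategy_def
  proof (intro allI impI conjI)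
    fix h assume h: "history P L h \<and> follows \<sigma> h"
    show "\<sigma> h \<in> P - set h" if "\<not> game_over P L h \<and> even (length h)"
      using inv[of h] h that \<sigma>[of h] by (auto simp: good_move_def)
    show "occupies_line L (first_points h)" if "game_over P L h"
      using inv[of h] h that by simp
  qed
  then show ?thesis unfolding first_player_win_def by blast
qed

section \<open>Transport of won positions along injections\<close>

lemma occupies_line_image:
  assumes "inj_on f P" "\<Union> L \<subseteq> P" "A \<subseteq> P"
  shows "occupies_line ((`) f ` L) (f ` A) \<longleftrightarrow> occupies_line L A"
proof -
  have "f ` l \<subseteq> f ` A \<longleftrightarrow> l \<subseteq> A" if "l \<in> L" for l
    using that assms inj_on_image_mem_iff[of f P _ A] by blast
  then show ?thesis unfolding occupies_line_def by simp
qed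

text \<open>The rules of \<open>wins\<close> mention only membership, complements in
  \<open>P\<close> and occupied lines, and an injection on \<open>P\<close> preserves and reflects
  all three. This carries the win on the explicit plane to any plane of order 4.\<close>

lemma wins_image:
  assumes "wins P L A B" "inj_on f P" "\<Union> L \<subseteq> P" "A \<subseteq> P" "B \<subseteq> P"
  shows "wins (f ` P) ((`) f ` L) (f ` A) (f ` B)"
  using assms
proof (induction rule: wins.induct)
  case (finish p A B)
  have "f p \<in> f ` P - (f ` A \<union> f ` B)"
    using finish.hyps finish.prems inj_on_image_mem_iff[of f P p A] inj_on_image_mem_iff[of f P p B]
    by blast
  moreover have "occupies_line ((`) f ` L) (insert (f p) (f ` A))"
    using occupies_line_image[of f P L "insert p A"] finish.hyps finish.prems by simp
  ultimately show ?case by (rule wins.finish)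
next
  case (step p A B)
  \<comment> \<open>The replies available in the image are exactly the images of the replies
    available before.\<close>
  have img: "f ` P - insert (f p) (f ` A \<union> f ` B) = f ` (P - insert p (A \<union> B))"
    using inj_on_image_set_diff[of f P P "insert p (A \<union> B)"] step.hyps(1) step.prems
    by (simp add: image_Un)
  show ?case
  proof (rule wins.step[of "f p"])
    show "f p \<in> f ` P - (f ` A \<union> f ` B)"
      using step.hyps(1) step.prems inj_on_image_mem_iff[of f P p A] inj_on_image_mem_iff[of f P p B]
      by blast
    show "f ` P \<noteq> insert (f p) (f ` A \<union> f ` B)"
      using img step.hyps step.prems by blast
    fix y assume "y \<in> f ` P - insert (f p) (f ` A \<union> f ` B)"
    then obtain q where q: "y = f q" "q \<in> P - insert p (A \<union> B)"
      unfolding img by blast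
    then show "\<not> occupies_line ((`) f ` L) (insert y (f ` B)) \<and>
        wins (f ` P) ((`) f ` L) (insert (f p) (f ` A)) (insert y (f ` B))"
      using step.IH[of q] step.hyps(1) step.prems occupies_line_image[of f P L "insert q B"]
      by simp
  qed
qed


section \<open>The plane of order 4\<close>

text \<open>The lines fixed by the choice of coordinates: four rows, four columns and the main
  diagonal.\<close>

definition grid_lines :: "nat list list" where
  "grid_lines =
    [[0,1,2,3], [4,5,6,7], [8,9,10,11], [12,13,14,15],
     [0,4,8,12], [1,5,9,13], [2,6,10,14], [3,7,11,15],
     [0,5,10,15]]"

text \<open>
  The number \<open>4 * i + j\<close> stands for row \<open>i\<close> and column \<open>j\<close>. Read as permutations \<open>i \<mapsto> j\<close>, the lines
  below are the 3-cycles, listed with their fixed point first, and the double transpositions; this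
  order makes the first two points determine the line.
\<close>

definition oblique_lines :: "nat list list" where
  "oblique_lines =
    [[0,6,11,13], [0,7,9,14], [5,2,11,12], [5,3,8,14], [10,1,7,12], [10,3,4,13], [15,1,6,8],
     [15,2,4,9], [1,4,11,14], [2,8,7,13], [3,12,6,9]]"

definition plane4 :: "nat set set" where
  "plane4 = set ` set (grid_lines @ oblique_lines)"

text \<open>A line different from the nine grid lines shares at most one point with each of them;
  hence the filter condition. Ranging over all \<open>a\<close> and \<open>b\<close> turns the
  uniqueness of the completion into a finite computation.\<close>

definition forced_line :: "nat list \<Rightarrow> bool" where
  "forced_line t \<longleftrightarrow> (\<forall>a\<in>set [0..<16]. \<forall>b\<in>set [0..<16].
     (let s = [t ! 0, t ! 1, a, b] in
      distinct s \<longrightarrow> (\<forall>m\<in>set grid_lines. length (filter (\<lambda>x. x \<in> set m) s) \<le> 1) \<longrightarrow>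
      set s = set t))"

lemma oblique_lines_forced: "\<forall>t\<in>set oblique_lines. forced_line t"
  by code_simp

lemma oblique_lines_start:
  "\<forall>t\<in>set oblique_lines. t ! 0 < 16 \<and> t ! 1 < 16 \<and> t ! 0 \<noteq> t ! 1 \<and>
     (\<forall>m\<in>set grid_lines. \<not> (t ! 0 \<in> set m \<and> t ! 1 \<in> set m))"
  by code_simp

lemma plane4_joins:
  "\<forall>p\<in>set [0..<16]. \<forall>q\<in>set [0..<16]. p \<noteq> q \<longrightarrow>
     (\<exists>l\<in>set (grid_lines @ oblique_lines). p \<in> set l \<and> q \<in> set l)"
  by code_simp

text \<open>The line of \<open>K\<close> through the first two points of an oblique line is not a
  grid line, so it is the forced one; this gives \<open>plane4 \<subseteq> K\<close>. Conversely,
  \<open>plane4\<close> already joins any two points, so uniqueness of joining lines leaves no room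
  for another line in \<open>K\<close>.\<close>

lemma plane4_unique:
  assumes sub: "\<And>l. l \<in> K \<Longrightarrow> l \<subseteq> {..<16} \<and> card l = 4"
    and join: "\<And>p q. p < 16 \<Longrightarrow> q < 16 \<Longrightarrow> p \<noteq> q \<Longrightarrow> \<exists>!l. l \<in> K \<and> p \<in> l \<and> q \<in> l"
    and grid: "set ` set grid_lines \<subseteq> K"
  shows "K = plane4"
proof -
  have meet: "l = m" if "l \<in> K" "m \<in> K" "p \<in> l" "p \<in> m" "q \<in> l" "q \<in> m" "p \<noteq> q" for l m p q
    using join[of p q] sub[of l] that by blast
  have "set t \<in> K" if t: "t \<in> set oblique_lines" for t
  proof -
    define p q where "p = t ! 0" and "q = t ! 1"
    have pq: "p < 16" "q < 16" "p \<noteq> q" "\<forall>m\<in>set grid_lines. \<not> (p \<in> set m \<and> q \<in> set m)"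
      using oblique_lines_start t unfolding p_def q_def by blast+
    obtain l where l: "l \<in> K" "p \<in> l" "q \<in> l" using join[OF pq(1-3)] by blast
    have fin: "finite l" using sub[OF l(1)] finite_subset by blast
    have "card (l - {p, q}) = 2" using sub[OF l(1)] l pq(3) fin by (simp add: card_Diff_subset)
    then obtain a b where ab: "l - {p, q} = {a, b}" "a \<noteq> b" by (auto simp: card_2_iff)
    then have leq: "l = set [p, q, a, b]" and dist: "distinct [p, q, a, b]"
      using l pq(3) by auto
    have "length (filter (\<lambda>x. x \<in> set m) [p, q, a, b]) \<le> 1" if m: "m \<in> set grid_lines" for m
    proof (rule ccontr)
      assume "\<not> ?thesis"
      moreover have "length (filter (\<lambda>x. x \<in> set m) [p, q, a, b]) = card (l \<inter> set m)"
        using distinct_card[OF distinct_filter[OF dist, of "\<lambda>x. x \<in> set m"]]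
        unfolding leq set_filter Int_def by simp
      ultimately have "\<not> card (l \<inter> set m) \<le> Suc 0" by simp
      then obtain x y where "x \<in> l \<inter> set m" "y \<in> l \<inter> set m" "x \<noteq> y"
        using card_le_Suc0_iff_eq[of "l \<inter> set m"] fin by blast
      \<comment> \<open>Two common points would make \<open>l\<close> a grid line, but
        \<open>p\<close> and \<open>q\<close> lie on no common grid line.\<close>
      then have "l = set m" using meet[of l "set m" x y] l(1) grid m by auto
      then show False using pq(4) m l by blast
    qed
    moreover have "a \<in> set [0..<16]" "b \<in> set [0..<16]"
      using sub[OF l(1)] leq by auto
    moreover have "forced_line t" using oblique_lines_forced t by blast
    ultimately have "set [p, q, a, b] = set t"
      using dist unfolding forced_line_def p_def[symmetric] q_def[symmetric] Let_def by blast
    then show ?thesis using l(1) leq by simp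
  qed
  then have le: "plane4 \<subseteq> K" using grid unfolding plane4_def by auto
  moreover have "l \<in> plane4" if l: "l \<in> K" for l
  proof -
    have "\<not> card l \<le> Suc 0" "finite l"
      using sub[OF l] finite_subset by auto
    then obtain p q where pq: "p \<in> l" "q \<in> l" "p \<noteq> q"
      using card_le_Suc0_iff_eq[of l] by blast
    then have "p \<in> set [0..<16]" "q \<in> set [0..<16]" using sub[OF l] by auto
    then obtain m where m: "m \<in> plane4" "p \<in> m" "q \<in> m"
      using plane4_joins pq(3) unfolding plane4_def by blast
    then show ?thesis using meet[of l m p q] l le pq by auto
  qed
  ultimately show ?thesis by blast
qed


section \<open>A strategy after the opening 0, 1\<close>

text \<open>
  \<open>Node p ts\<close> is the advice to choose \<open>p\<close>; \<open>ts\<close> lists how to go on after those replies that do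
  not allow the first player to complete a line at once.
\<close>

datatype strategy_tree = Node nat "(nat \<times> strategy_tree) list"

text \<open>Each \<open>r\<close> is the part of a line that \<open>A\<close> still misses. The
  result collects the points of \<open>F\<close> with which the owner of \<open>A\<close> completes
  a line at once; a point that completes several lines is repeated.\<close>

definition threats :: "nat list \<Rightarrow> nat list \<Rightarrow> nat list" where
  "threats F A = concat (filter (\<lambda>r. length r = 1 \<and> set r \<subseteq> set F)
     (map (filter (\<lambda>x. x \<notin> set A)) (grid_lines @ oblique_lines)))"

text \<open>Moves that complete a line are not nodes: if a threat other than \<open>q\<close>
  survives the reply \<open>q\<close>, the first player executes it, and only the other replies need
  a subtree. So a leaf makes at least two threats. The test on \<open>threats F' B\<close> shows
  that the second player cannot complete a line by his reply, and \<open>F' \<noteq> []\<close>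
  excludes a full board.\<close>

fun valid_tree :: "nat list \<Rightarrow> nat list \<Rightarrow> nat list \<Rightarrow> strategy_tree \<Rightarrow> bool" where
  "valid_tree F A B (Node p ts) = (
     let F' = removeAll p F; W = threats F' (p # A) in
     p \<in> set F \<and> F' \<noteq> [] \<and> threats F' B = [] \<and>
     (\<forall>q\<in>set F'. removeAll q W \<noteq> [] \<or> q \<in> set (map fst ts)) \<and>
     (\<forall>(q, t)\<in>set ts. valid_tree (removeAll q F') (p # A) (q # B) t))"

text \<open>Found by an exhaustive search for the smallest tree.\<close>

definition tree4 :: strategy_tree where
  "tree4 =
Node 4 [(2, Node 8 [(12, Node 5 [(3, Node 6 [(7, Node 10 [(15, Node 11 [])])]), (6, Node 3 [(14,
Node 10 [])]), (7, Node 10 [(15, Node 3 [])]), (9, Node 3 [(14, Node 10 [])]), (10, Node 7 [(6,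
Node 14 [])]), (11, Node 3 [(14, Node 10 [])]), (13, Node 7 [(6, Node 14 [])]), (14, Node 6 [(7,
Node 10 [(15, Node 13 [])])]), (15, Node 7 [(6, Node 14 [])])])]), (3, Node 8 [(12, Node 7 [(2,
Node 5 [(6, Node 9 [(14, Node 10 [])])]), (5, Node 2 [(13, Node 9 [])]), (6, Node 9 [(14, Node 2
[])]), (9, Node 6 [(5, Node 13 [])]), (10, Node 2 [(13, Node 9 [])]), (11, Node 2 [(13, Node 9
[])]), (13, Node 5 [(6, Node 9 [(14, Node 15 [])])]), (14, Node 6 [(5, Node 13 [])]), (15, Node 6
[(5, Node 13 [])])])]), (5, Node 9 [(2, Node 12 [(8, Node 6 [(3, Node 14 [(7, Node 13 [])])])]),
(3, Node 2 [(15, Node 7 [(14, Node 8 [])])]), (6, Node 2 [(15, Node 8 [(12, Node 7 [])])]), (7,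
Node 12 [(8, Node 3 [(6, Node 15 [(2, Node 13 [])])])]), (8, Node 14 [(7, Node 13 [(2, Node 3
[(10, Node 12 [])]), (3, Node 15 []), (6, Node 15 []), (10, Node 12 [(15, Node 6 [])]), (11, Node
15 []), (12, Node 10 [(3, Node 2 [])]), (15, Node 6 [(11, Node 3 [])])])]), (10, Node 2 [(15, Node
7 [(14, Node 8 [])])]), (11, Node 2 [(15, Node 7 [(14, Node 8 [])])]), (12, Node 2 [(15, Node 13
[(3, Node 7 []), (6, Node 8 [(7, Node 10 [])]), (7, Node 10 [(3, Node 11 [])]), (8, Node 6 [(11,
Node 10 [])]), (10, Node 7 []), (11, Node 7 []), (14, Node 8 [(7, Node 10 [])])])]), (13, Node 2
[(15, Node 8 [(12, Node 14 [(7, Node 10 [])])])]), (14, Node 2 [(15, Node 8 [(12, Node 13 [(7,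
Node 10 [])])])]), (15, Node 7 [(14, Node 8 [(12, Node 13 [(2, Node 11 [])])])])]), (6, Node 12
[(8, Node 15 [(2, Node 10 [(5, Node 13 [])]), (3, Node 2 [(9, Node 5 [])]), (5, Node 9 [(2, Node
14 [])]), (7, Node 2 [(9, Node 5 [])]), (9, Node 10 [(5, Node 13 [])]), (10, Node 9 [(2, Node 14
[])]), (11, Node 9 [(2, Node 14 [])]), (13, Node 2 [(9, Node 5 [])]), (14, Node 2 [(9, Node 5
[])])])]), (7, Node 8 [(12, Node 10 [(2, Node 3 [(13, Node 5 [])]), (3, Node 9 [(11, Node 15
[])]), (5, Node 11 [(9, Node 13 [])]), (6, Node 3 [(13, Node 5 [])]), (9, Node 3 [(13, Node 5
[])]), (11, Node 3 [(13, Node 5 [])]), (13, Node 9 [(11, Node 15 [])]), (14, Node 9 [(11, Node 15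
[])]), (15, Node 11 [(9, Node 13 [])])])]), (8, Node 6 [(2, Node 5 [(7, Node 13 [(11, Node 10
[])])]), (3, Node 5 [(7, Node 10 [(15, Node 11 [(13, Node 2 [])])])]), (5, Node 13 [(11, Node 9
[(2, Node 12 [(3, Node 14 [])]), (3, Node 14 [(7, Node 15 [])]), (7, Node 3 []), (10, Node 12 [(3,
Node 14 [])]), (12, Node 2 [(15, Node 10 [])]), (14, Node 3 []), (15, Node 3 [])])]), (7, Node 13
[(11, Node 10 [(3, Node 15 [(5, Node 14 [])])])]), (9, Node 5 [(7, Node 10 [(15, Node 13 [])])]),
(10, Node 7 [(5, Node 9 [(14, Node 3 [(12, Node 11 [])])])]), (11, Node 9 [(2, Node 7 []), (3,
Node 7 []), (5, Node 2 [(15, Node 14 [])]), (7, Node 2 [(15, Node 3 [(12, Node 10 [])])]), (10,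
Node 7 []), (12, Node 7 []), (13, Node 7 []), (14, Node 5 [(7, Node 15 [])]), (15, Node 7 [])]),
(12, Node 5 [(7, Node 10 [(15, Node 13 [])])]), (13, Node 7 [(5, Node 9 [(14, Node 3 [(12, Node 15
[])])])]), (14, Node 5 [(7, Node 10 [(15, Node 13 [])])]), (15, Node 7 [(5, Node 9 [(14, Node 3
[(12, Node 13 [])])])])]), (9, Node 5 [(2, Node 6 [(7, Node 10 [(15, Node 13 [])])]), (3, Node 6
[(7, Node 11 [(13, Node 12 [])])]), (6, Node 8 [(12, Node 3 [(14, Node 10 [])])]), (7, Node 8
[(12, Node 10 [(15, Node 3 [])])]), (8, Node 6 [(7, Node 10 [(15, Node 13 [])])]), (10, Node 6
[(7, Node 12 [(8, Node 11 [])])]), (11, Node 8 [(12, Node 3 [(14, Node 10 [])])]), (12, Node 6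
[(7, Node 10 [(15, Node 13 [])])]), (13, Node 6 [(7, Node 8 [(12, Node 10 [(15, Node 14 [])])])]),
(14, Node 6 [(7, Node 10 [(15, Node 13 [])])]), (15, Node 6 [(7, Node 11 [(13, Node 12 [])])])]),
(10, Node 8 [(12, Node 7 [(2, Node 5 [(6, Node 14 [])]), (3, Node 2 [(13, Node 9 [])]), (5, Node 2
[(13, Node 9 [])]), (6, Node 2 [(13, Node 9 [])]), (9, Node 6 [(5, Node 13 [])]), (11, Node 2
[(13, Node 9 [])]), (13, Node 5 [(6, Node 14 [])]), (14, Node 6 [(5, Node 13 [])]), (15, Node 5
[(6, Node 14 [])])])]), (11, Node 8 [(12, Node 5 [(2, Node 3 [(14, Node 10 [])]), (3, Node 7 [(6,
Node 9 [(14, Node 2 [])])]), (6, Node 3 [(14, Node 10 [])]), (7, Node 10 [(15, Node 3 [])]), (9,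
Node 3 [(14, Node 10 [])]), (10, Node 7 [(6, Node 14 [])]), (13, Node 7 [(6, Node 14 [])]), (14,
Node 7 [(6, Node 2 [(13, Node 15 [])])]), (15, Node 7 [(6, Node 14 [])])])]), (12, Node 7 [(2,
Node 5 [(6, Node 14 [(9, Node 3 [(8, Node 15 [])])])]), (3, Node 5 [(6, Node 9 [(14, Node 15
[])])]), (5, Node 9 [(14, Node 13 [(2, Node 11 [(6, Node 10 [])]), (3, Node 8 [(2, Node 11 [])]),
(6, Node 2 []), (8, Node 3 [(10, Node 11 [])]), (10, Node 2 []), (11, Node 2 []), (15, Node 8 [(2,
Node 11 [])])])]), (6, Node 9 [(14, Node 15 [(2, Node 10 [(5, Node 11 [])])])]), (8, Node 5 [(6,
Node 15 [(10, Node 9 [])])]), (9, Node 6 [(5, Node 13 [(11, Node 2 [(8, Node 10 [])])])]), (10,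
Node 6 [(5, Node 9 [(14, Node 2 [(15, Node 13 [])])])]), (11, Node 5 [(6, Node 9 [(14, Node 15
[])])]), (13, Node 5 [(6, Node 9 [(14, Node 15 [])])]), (14, Node 13 [(2, Node 6 []), (3, Node 6
[]), (5, Node 3 [(10, Node 11 [])]), (6, Node 2 [(8, Node 15 [(9, Node 3 [])])]), (8, Node 6 []),
(9, Node 6 []), (10, Node 6 []), (11, Node 5 [(6, Node 10 [])]), (15, Node 6 [])]), (15, Node 6
[(5, Node 13 [(11, Node 2 [(8, Node 10 [])])])])]), (13, Node 5 [(2, Node 7 [(6, Node 8 [(12, Node
14 [])])]), (3, Node 7 [(6, Node 9 [(14, Node 15 [])])]), (6, Node 12 [(8, Node 15 [(10, Node 2
[])])]), (7, Node 12 [(8, Node 2 [(11, Node 15 [])])]), (8, Node 7 [(6, Node 15 [(10, Node 9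
[])])]), (9, Node 6 [(7, Node 8 [(12, Node 10 [(15, Node 14 [])])])]), (10, Node 7 [(6, Node 8
[(12, Node 14 [])])]), (11, Node 7 [(6, Node 8 [(12, Node 14 [])])]), (12, Node 7 [(6, Node 9
[(14, Node 15 [])])]), (14, Node 12 [(8, Node 2 [(11, Node 15 [])])]), (15, Node 7 [(6, Node 8
[(12, Node 14 [])])])]), (14, Node 8 [(12, Node 10 [(2, Node 11 [(9, Node 13 [])]), (3, Node 9
[(11, Node 15 [])]), (5, Node 11 [(9, Node 13 [])]), (6, Node 9 [(11, Node 15 [])]), (7, Node 9
[(11, Node 15 [])]), (9, Node 5 [(15, Node 13 [(3, Node 6 [])])]), (11, Node 5 [(15, Node 13 [(3,
Node 7 [])])]), (13, Node 15 [(5, Node 9 [])]), (15, Node 13 [(3, Node 11 [])])])]), (15, Node 12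
[(8, Node 6 [(2, Node 3 [(9, Node 13 [])]), (3, Node 5 [(7, Node 11 [])]), (5, Node 3 [(9, Node 13
[])]), (7, Node 3 [(9, Node 13 [])]), (9, Node 5 [(7, Node 11 [])]), (10, Node 5 [(7, Node 11
[])]), (11, Node 7 [(5, Node 9 [])]), (13, Node 7 [(5, Node 9 [])]), (14, Node 3 [(9, Node 13
[])])])])]"

lemma valid_tree4: "valid_tree [2..<16] [0] [1] tree4"
  by code_simp

section \<open>Soundness of the tree check\<close>

lemma plane4_distinct: "\<forall>l\<in>set (grid_lines @ oblique_lines). distinct l"
  by code_simp

lemma plane4_subset: "\<forall>l\<in>set (grid_lines @ oblique_lines). \<forall>x\<in>set l. x < 16"
  by code_simp

lemma plane4_not_subset_1: "\<forall>l\<in>set (grid_lines @ oblique_lines). \<not> set l \<subseteq> {1}"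
  by code_simp

lemma threats_occupy:
  assumes "w \<in> set (threats F A)"
  shows "w \<in> set F" "occupies_line plane4 (insert w (set A))"
proof -
  obtain l where l: "l \<in> set (grid_lines @ oblique_lines)" "w \<in> set (filter (\<lambda>x. x \<notin> set A) l)"
    "length (filter (\<lambda>x. x \<notin> set A) l) = 1" "set (filter (\<lambda>x. x \<notin> set A) l) \<subseteq> set F"
    using assms unfolding threats_def by auto
  then show "w \<in> set F" by blast
  obtain v where "filter (\<lambda>x. x \<notin> set A) l = [v]"
    using l(3) by (auto simp: length_Suc_conv)
  then have "filter (\<lambda>x. x \<notin> set A) l = [w]" using l(2) by simp
  then have "set (filter (\<lambda>x. x \<notin> set A) l) = {w}" by simp
  then have "set l \<subseteq> insert w (set A)" by auto
  then show "occupies_line plane4 (insert w (set A))"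
    using l(1) unfolding occupies_line_def plane4_def by blast
qed

text \<open>Completeness of \<open>threats\<close>: as \<open>B\<close> holds no line yet, the line
  completed by \<open>q\<close> misses exactly \<open>q\<close>. Hence an empty list certifies that
  no reply completes a line.\<close>

lemma occupies_line_threat:
  assumes "occupies_line plane4 (insert q (set B))" "\<not> occupies_line plane4 (set B)" "q \<in> set F"
  shows "threats F B \<noteq> []"
proof -
  obtain l where l: "l \<in> set (grid_lines @ oblique_lines)" "set l \<subseteq> insert q (set B)"
    using assms(1) unfolding occupies_line_def plane4_def by blast
  have "\<not> set l \<subseteq> set B"
    using assms(2) l(1) unfolding occupies_line_def plane4_def by blast
  then have eq: "set (filter (\<lambda>x. x \<notin> set B) l) = {q}" using l(2) by auto
  \<comment> \<open>\<open>threats\<close> tests the length of a list, and only a repetition-free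
    list with a singleton set must have length 1.\<close>
  moreover have "distinct (filter (\<lambda>x. x \<notin> set B) l)" using plane4_distinct l(1) by simp
  ultimately have "length (filter (\<lambda>x. x \<notin> set B) l) = 1"
    using distinct_card by fastforce
  then have "q \<in> set (threats F B)"
    unfolding threats_def set_concat set_filter set_map using l(1) eq assms(3)
    by (intro UN_I[of "filter (\<lambda>x. x \<notin> set B) l"]) auto
  then show ?thesis by auto
qed

text \<open>Every node is an instance of \<open>wins.step\<close>. After a reply, either a surviving
  threat gives \<open>wins.finish\<close> or the subtree for that reply applies.\<close>

lemma valid_tree_wins:
  assumes "valid_tree F A B t" "set F = {..<16} - (set A \<union> set B)"
    "\<not> occupies_line plane4 (set B)"
  shows "wins {..<16} plane4 (set A) (set B)"
  using assms
proof (induction F A B t rule: valid_tree.induct)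
  case (1 F A B p ts)
  define F' where "F' = removeAll p F"
  have F': "set F' = {..<16} - insert p (set A \<union> set B)"
    using "1.prems"(2) by (auto simp: F'_def)
  have v: "p \<in> set F" "F' \<noteq> []" "threats F' B = []"
    "\<And>q. q \<in> set F' \<Longrightarrow> removeAll q (threats F' (p # A)) \<noteq> [] \<or> q \<in> fst ` set ts"
    "\<And>q t. (q, t) \<in> set ts \<Longrightarrow> valid_tree (removeAll q F') (p # A) (q # B) t"
    using "1.prems"(1) unfolding valid_tree.simps Let_def F'_def[symmetric] by auto
  show ?case
  proof (rule wins.step[of p])
    show "p \<in> {..<16} - (set A \<union> set B)" using v(1) "1.prems"(2) by simp
    show "{..<16} \<noteq> insert p (set A \<union> set B)" 
    proof -
      have "set F' \<noteq> {}" using v(2) by simp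
      then show ?thesis unfolding F' by blast
    qed
    fix q assume "q \<in> {..<16} - insert p (set A \<union> set B)"
    then have q: "q \<in> set F'" using F' by simp
    have no: "\<not> occupies_line plane4 (insert q (set B))"
      using occupies_line_threat[OF _ "1.prems"(3) q] v(3) by blast
    moreover have "wins {..<16} plane4 (insert p (set A)) (insert q (set B))"
    \<comment> \<open>With no threat left besides \<open>q\<close> itself, the check guarantees a
      subtree for \<open>q\<close>; otherwise some \<open>w \<noteq> q\<close> wins at once.\<close>
    proof (cases "removeAll q (threats F' (p # A)) = []")
      case True
      then obtain t where t: "(q, t) \<in> set ts" using v(4)[OF q] by auto
      have "wins {..<16} plane4 (set (p # A)) (set (q # B))"
      proof (rule "1.IH"[OF F'_def refl t refl, folded F'_def])
        show "valid_tree (removeAll q F') (p # A) (q # B) t" by (rule v(5)[OF t])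
        show "set (removeAll q F') = {..<16} - (set (p # A) \<union> set (q # B))" using F' by auto
        show "\<not> occupies_line plane4 (set (q # B))" using no by simp
      qed
      then show ?thesis by simp
    next
      case False
      then have "set (removeAll q (threats F' (p # A))) \<noteq> {}" unfolding set_empty .
      then obtain w where w: "w \<in> set (threats F' (p # A))" "w \<noteq> q" by auto
      show ?thesis
        using threats_occupy[OF w(1)] w(2) F' by (intro wins.finish[of w]) auto
    qed
    ultimately show "\<not> occupies_line plane4 (insert q (set B)) \<and>
      wins {..<16} plane4 (insert p (set A)) (insert q (set B))" by blast
  qed
qed

lemma wins_plane4: "wins {..<16} plane4 {0} {1}"
proof -
  have "wins {..<16} plane4 (set [0]) (set [1])"
  proof (rule valid_tree_wins[OF valid_tree4])
    have "set [2..<16] = set [0..<16] - (set [0] \<union> set [1])" by code_simp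
    then show "set [2..<16] = {..<16} - (set [0] \<union> set [1])"
      by (simp only: atLeast_upt)
    show "\<not> occupies_line plane4 (set [1])"
      using plane4_not_subset_1 unfolding occupies_line_def plane4_def by simp
  qed
  then show ?thesis by simp
qed


section \<open>Coordinates\<close>

lemma affine_planeD:
  assumes "affine_plane n P L"
  shows "finite P" "card P = n\<^sup>2" "\<forall>l\<in>L. l \<subseteq> P \<and> card l = n"
    "\<forall>p\<in>P. \<forall>q\<in>P. p \<noteq> q \<longrightarrow> (\<exists>!l. l \<in> L \<and> p \<in> l \<and> q \<in> l)"
    "\<exists>C. partition_on L C \<and> card C = n + 1 \<and> (\<forall>c\<in>C. partition_on P c)"
  using assms unfolding affine_plane_def by - (elim conjE, assumption)+

text \<open>Counting the points along the disjoint lines of \<open>c\<close> gives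
  \<open>n\<^sup>2 = card c * n\<close>, and \<open>n\<close> can be cancelled.\<close>

lemma affine_plane_class_card:
  assumes "affine_plane n P L" "n > 0" "partition_on P c" "c \<subseteq> L"
  shows "card c = n"
proof -
  have fin: "finite P" "card P = n\<^sup>2" "\<And>l. l \<in> c \<Longrightarrow> l \<subseteq> P \<and> card l = n"
    using affine_planeD(1-3)[OF assms(1)] assms(4) by auto
  have "card P = card (\<Union> c)" using partition_onD1[OF assms(3)] by simp
  also have "\<dots> = sum card c"
    using partition_onD2[OF assms(3)] finite_subset[OF _ fin(1)] fin(3)
    by (intro card_Union_disjoint) (auto simp: disjoint_def pairwise_def disjnt_def)
  also have "\<dots> = card c * n" using fin(3) by simp
  finally show ?thesis using fin(2) assms(2) by (simp add: power2_eq_square)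
qed

text \<open>A line \<open>D\<close> of a third class meets every row and every column exactly once.
  Numbering its points therefore numbers rows and columns together and makes \<open>D\<close> the
  main diagonal.\<close>

lemma affine_plane_4_coordinates:
  assumes plane: "affine_plane 4 P L" and pq: "p \<in> P" "q \<in> P" "p \<noteq> q"
  obtains f :: "nat \<Rightarrow> 'a" where "bij_betw f {..<16} P" "f 0 = p" "f 1 = q" "L = (`) f ` plane4"
proof -
  have P: "finite P" "card P = 16" and lines: "\<And>l. l \<in> L \<Longrightarrow> l \<subseteq> P \<and> card l = 4"
    and join: "\<And>x y. x \<in> P \<Longrightarrow> y \<in> P \<Longrightarrow> x \<noteq> y \<Longrightarrow> \<exists>!l. l \<in> L \<and> x \<in> l \<and> y \<in> l"
    using affine_planeD[OF plane] by simp_all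
  obtain C where C: "partition_on L C" "card C = 5" "\<And>c. c \<in> C \<Longrightarrow> partition_on P c"
    using affine_planeD(5)[OF plane] by auto
  have C_sub: "c \<subseteq> L" if "c \<in> C" for c using C(1) that unfolding partition_on_def by blast
  have card_class: "card c = 4" if "c \<in> C" for c
    using affine_plane_class_card[OF plane _ C(3) C_sub] that by simp
  have fin_class: "finite c" if "c \<in> C" for c using card_class[OF that] card.infinite by fastforce
  define line where "line c x = (THE l. l \<in> c \<and> x \<in> l)" for c :: "'a set set" and x
  have line_unique: "\<exists>!l. l \<in> c \<and> x \<in> l" if "c \<in> C" "x \<in> P" for c x
    using C(3)[OF that(1)] that(2) unfolding partition_on_def disjoint_def by blast
  have line: "line c x \<in> c" "x \<in> line c x" if "c \<in> C" "x \<in> P" for c x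
    using theI'[OF line_unique[OF that]] unfolding line_def by auto
  have line_eq: "line c x = l" if "c \<in> C" "l \<in> c" "x \<in> l" for c x l
    using line_unique[OF that(1), of x] line[OF that(1), of x] lines[of l] C_sub[OF that(1)] that
    by blast
  \<comment> \<open>If two distinct points were joined both in \<open>c\<close> and in
    \<open>d\<close>, their unique common line would lie in two disjoint classes.\<close>
  have meet: "x = y" if "c \<in> C" "d \<in> C" "c \<noteq> d" "x \<in> P" "y \<in> P" "line c x = line c y"
    "line d x = line d y" for c d x y
  proof (rule ccontr)
    assume "x \<noteq> y"
    then have "line c x = line d x"
      using join[of x y] line[of c x] line[of c y] line[of d x] line[of d y] C_sub that
      by (metis subsetD)
    then show False
      using line(1)[OF that(1,4)] line(1)[OF that(2,4)] partition_onD2[OF C(1)] that(1-3)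
      unfolding disjoint_def by auto
  qed

  obtain m where m: "m \<in> L" "p \<in> m" "q \<in> m" using join[OF pq] by blast
  then obtain c1 where c1: "c1 \<in> C" "m \<in> c1" using partition_onD1[OF C(1)] by blast
  have "finite C" using C(2) card.infinite by fastforce
  then have "\<not> C \<subseteq> {c1}" using C(2) card_mono[of "{c1}" C] by auto
  then obtain c2 where c2: "c2 \<in> C" "c2 \<noteq> c1" by blast
  have "card {c1, c2} \<le> 2" by (simp add: card_insert_if)
  then have "\<not> C \<subseteq> {c1, c2}" using C(2) card_mono[of "{c1, c2}" C] by auto
  then obtain c3 where c3: "c3 \<in> C" "c3 \<noteq> c1" "c3 \<noteq> c2" by blast
  define D where "D = line c3 p"
  have D: "D \<in> c3" "p \<in> D" using line[OF c3(1) pq(1)] unfolding D_def by auto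
  then have DL: "D \<subseteq> P" "card D = 4" using lines C_sub[OF c3(1)] by auto
  have inj_D: "inj_on (line c) D" if "c \<in> C" "c \<noteq> c3" for c
  proof (rule inj_onI)
    fix x y assume "x \<in> D" "y \<in> D" "line c x = line c y"
    then show "x = y"
      using meet[OF that(1) c3(1) that(2), of x y] line_eq[OF c3(1) D(1)] DL(1) by blast
  qed
  have onto_D: "line c ` D = c" if "c \<in> C" "c \<noteq> c3" for c
    using card_image[OF inj_D[OF that]] card_class[OF that(1)] DL line(1)[OF that(1)]
    by (intro card_subset_eq fin_class[OF that(1)]) auto
  \<comment> \<open>The lines of \<open>c1\<close> serve as rows and those of \<open>c2\<close> as
    columns.\<close>
  define co where "co x = (line c1 x, line c2 x)" for x
  have inj_co: "inj_on co P"
    using meet[OF c1(1) c2(1)] c2(2) by (intro inj_onI) (auto simp: co_def)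
  have onto_co: "co ` P = c1 \<times> c2"
    using card_image[OF inj_co] P card_class c1(1) c2(1) line(1)
    by (intro card_subset_eq finite_cartesian_product fin_class) (auto simp: co_def card_cartesian_product)

  have "line c2 q \<in> line c2 ` D" using onto_D[OF c2(1)] c3 line(1)[OF c2(1) pq(2)] by auto
  \<comment> \<open>\<open>d1\<close> is the point of the diagonal in the column of
    \<open>q\<close>; as second entry of \<open>ds\<close> it gives that column the number
    1.\<close>
  then obtain d1 where d1: "d1 \<in> D" "line c2 d1 = line c2 q" by force
  have rpq: "line c1 p = line c1 q" using line_eq[OF c1] m by simp
  \<comment> \<open>\<open>p\<close> and \<open>q\<close> share a row, so being distinct they do not
    share a column.\<close>
  then have "d1 \<noteq> p" using meet[OF c1(1) c2(1)] c2(2) pq d1(2) by metis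
  have finD: "finite D" using DL(1) P(1) finite_subset by blast
  then have "card (D - {p, d1}) = 2" using DL(2) D(2) d1(1) \<open>d1 \<noteq> p\<close> by (simp add: card_Diff_subset)
  then obtain d2 d3 where d23: "D - {p, d1} = {d2, d3}" "d2 \<noteq> d3" by (auto simp: card_2_iff)
  define ds where "ds = [p, d1, d2, d3]"
  have ds: "distinct ds" "set ds = D" "length ds = 4"
    using d23 \<open>d1 \<noteq> p\<close> D(2) d1(1) unfolding ds_def by auto
  have ds_P: "ds ! i \<in> D" "ds ! i \<in> P" if "i < 4" for i
    using ds DL(1) nth_mem[of i ds] that by auto
  have line_ds_eq: "i = j" if "line c (ds ! i) = line c (ds ! j)" "i < 4" "j < 4" "c \<in> C" "c \<noteq> c3" for c i j
    using inj_onD[OF inj_D[OF that(4,5)] that(1)] ds_P that ds nth_eq_iff_index_eq by metis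

  \<comment> \<open>The number \<open>4 * a + b\<close> goes to the point in the row of
    \<open>ds ! a\<close> and the column of \<open>ds ! b\<close>.\<close>
  define f where "f i = inv_into P co (line c1 (ds ! (i div 4)), line c2 (ds ! (i mod 4)))" for i
  have co_f: "co (f i) = (line c1 (ds ! (i div 4)), line c2 (ds ! (i mod 4)))"
    and f_P: "f i \<in> P" if "i < 16" for i
  proof -
    have "(line c1 (ds ! (i div 4)), line c2 (ds ! (i mod 4))) \<in> co ` P"
      unfolding onto_co using that c1 c2 line(1) ds_P by auto
    then show "co (f i) = (line c1 (ds ! (i div 4)), line c2 (ds ! (i mod 4)))" "f i \<in> P"
      unfolding f_def by (auto intro: f_inv_into_f inv_into_into)
  qed
  have f_eqI: "f i = x" if "i < 16" "x \<in> P" "line c1 x = line c1 (ds ! (i div 4))"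
    "line c2 x = line c2 (ds ! (i mod 4))" for i x
    using inj_onD[OF inj_co, of "f i" x] co_f[OF that(1)] f_P[OF that(1)] that
    by (simp add: co_def)
  have inj_f: "inj_on f {..<16}"
  proof (rule inj_onI)
    fix i j :: nat assume ij: "i \<in> {..<16}" "j \<in> {..<16}" "f i = f j"
    then have "co (f i) = co (f j)" by simp
    then have "line c1 (ds ! (i div 4)) = line c1 (ds ! (j div 4))"
      "line c2 (ds ! (i mod 4)) = line c2 (ds ! (j mod 4))"
      using co_f[of i] co_f[of j] ij(1,2) by simp_all
    then have "i div 4 = j div 4" "i mod 4 = j mod 4"
      using ij line_ds_eq[of c1 "i div 4" "j div 4"] line_ds_eq[of c2 "i mod 4" "j mod 4"] c1 c2 c3
      by auto
    then show "i = j" by (metis div_mult_mod_eq)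
  qed
  have f_onto: "f ` {..<16} = P"
    using card_image[OF inj_f] P f_P by (intro card_subset_eq) auto
  \<comment> \<open>Four distinct points inside a line of four points are the whole line.\<close>
  have f_line: "f ` S \<in> L" if "l \<in> L" "S \<subseteq> {..<16}" "card S = 4" "\<And>i. i \<in> S \<Longrightarrow> f i \<in> l" for S l
  proof -
    have "f ` S = l"
      using lines[OF that(1)] that P(1) card_image[OF inj_on_subset[OF inj_f that(2)]]
      by (intro card_subset_eq) (auto intro: finite_subset)
    then show ?thesis using that(1) by simp
  qed
  have row: "f i \<in> line c1 (ds ! k)" if "i < 16" "i div 4 = k" for i k
    using co_f[OF that(1)] line(2)[OF c1(1) f_P[OF that(1)]] that(2) by (auto simp: co_def)
  have col: "f i \<in> line c2 (ds ! k)" if "i < 16" "i mod 4 = k" for i k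
    using co_f[OF that(1)] line(2)[OF c2(1) f_P[OF that(1)]] that(2) by (auto simp: co_def)
  have diag: "f i \<in> D" if "i < 16" "i div 4 = i mod 4" for i
    using f_eqI[OF that(1), of "ds ! (i mod 4)"] ds_P[of "i mod 4"] that(2) by simp

  \<comment> \<open>The lines of the plane pulled back to numbers; \<open>plane4_unique\<close>
    identifies them once the rows, columns and diagonal are found among them.\<close>
  define K where "K = {l. l \<subseteq> {..<16} \<and> f ` l \<in> L}"
  have c_line: "line c (ds ! k) \<in> L" if "c \<in> C" "k < 4" for c k
    using line(1)[OF that(1) ds_P(2)[OF that(2)]] C_sub[OF that(1)] by blast
  have row_K: "S \<in> K" if "k < 4" "S \<subseteq> {..<16}" "card S = 4" "\<forall>i\<in>S. i div 4 = k" for S k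
    using f_line[OF c_line[OF c1(1) that(1)] that(2,3)] row that unfolding K_def by blast
  have col_K: "S \<in> K" if "k < 4" "S \<subseteq> {..<16}" "card S = 4" "\<forall>i\<in>S. i mod 4 = k" for S k
    using f_line[OF c_line[OF c2(1) that(1)] that(2,3)] col that unfolding K_def by blast
  have diag_K: "S \<in> K" if "S \<subseteq> {..<16}" "card S = 4" "\<forall>i\<in>S. i div 4 = i mod 4" for S
    using f_line[of D, OF _ that(1,2)] D(1) C_sub[OF c3(1)] diag that unfolding K_def by blast
  have K: "K = plane4"
  proof (rule plane4_unique)
    fix l assume "l \<in> K"
    then show "l \<subseteq> {..<16} \<and> card l = 4"
      using lines[of "f ` l"] card_image[OF inj_on_subset[OF inj_f, of l]] unfolding K_def by simp
  next
    fix i j :: nat assume ij: "i < 16" "j < 16" "i \<noteq> j"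
    then have "f i \<noteq> f j" using inj_f by (auto simp: inj_on_def)
    then obtain m where m: "m \<in> L" "f i \<in> m" "f j \<in> m"
      "\<And>m'. m' \<in> L \<Longrightarrow> f i \<in> m' \<Longrightarrow> f j \<in> m' \<Longrightarrow> m' = m"
      using join[of "f i" "f j"] f_P ij by metis
    have img: "f ` {k \<in> {..<16}. f k \<in> m} = m"
      using f_onto lines[OF m(1)] by blast
    show "\<exists>!l. l \<in> K \<and> i \<in> l \<and> j \<in> l"
    proof (rule ex1I[of _ "{k \<in> {..<16}. f k \<in> m}"])
      show "{k \<in> {..<16}. f k \<in> m} \<in> K \<and> i \<in> {k \<in> {..<16}. f k \<in> m} \<and> j \<in> {k \<in> {..<16}. f k \<in> m}"
        unfolding K_def mem_Collect_eq img using m(1-3) ij(1,2) by blast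
      fix l assume l: "l \<in> K \<and> i \<in> l \<and> j \<in> l"
      then have "f ` l = m" using m(4) unfolding K_def by blast
      then show "l = {k \<in> {..<16}. f k \<in> m}"
        using l inj_on_image_eq_iff[OF inj_f, of l "{k \<in> {..<16}. f k \<in> m}"]
        unfolding K_def img by blast
    qed
  next
    show "set ` set grid_lines \<subseteq> K"
    proof -
      have "set [0,1,2,3] \<in> K" by (rule row_K[of 0]) simp_all
      moreover have "set [4,5,6,7] \<in> K" by (rule row_K[of 1]) simp_all
      moreover have "set [8,9,10,11] \<in> K" by (rule row_K[of 2]) simp_all
      moreover have "set [12,13,14,15] \<in> K" by (rule row_K[of 3]) simp_all
      moreover have "set [0,4,8,12] \<in> K" by (rule col_K[of 0]) simp_all
      moreover have "set [1,5,9,13] \<in> K" by (rule col_K[of 1]) simp_all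
      moreover have "set [2,6,10,14] \<in> K" by (rule col_K[of 2]) simp_all
      moreover have "set [3,7,11,15] \<in> K" by (rule col_K[of 3]) simp_all
      moreover have "set [0,5,10,15] \<in> K" by (rule diag_K) simp_all
      ultimately show ?thesis unfolding grid_lines_def by simp
    qed
  qed
  have "L = (`) f ` K"
  proof
    show "L \<subseteq> (`) f ` K"
    proof
      fix m assume m: "m \<in> L"
      then have "m = f ` {k \<in> {..<16}. f k \<in> m}" using f_onto lines[OF m] by blast
      then show "m \<in> (`) f ` K" using m unfolding K_def by (intro image_eqI) auto
    qed
  qed (auto simp: K_def)
  moreover have "bij_betw f {..<16} P" using inj_f f_onto by (simp add: bij_betw_def)
  moreover have "f 0 = p" using pq(1) by (intro f_eqI) (auto simp: ds_def)
  \<comment> \<open>\<open>q\<close> lies in the row of \<open>p\<close>, which is row 0, and in the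
    column of \<open>d1\<close>, which is column 1.\<close>
  moreover have "f 1 = q" using pq(2) rpq d1(2) by (intro f_eqI) (auto simp: ds_def)
  ultimately show ?thesis using that K by blast
qed

section \<open>Reduction of every opening to 0, 1\<close>

theorem mainTheorem1:
  fixes P :: "'a set" and L :: "'a set set"
  assumes "affine_plane 4 P L"
  shows "first_player_win P L"
proof (rule first_player_win_if_wins)
  have P: "card P = 16" and lines: "\<And>l. l \<in> L \<Longrightarrow> card l = 4"
    using affine_planeD(2,3)[OF assms] by simp_all
  show "{} \<notin> L" using lines by fastforce
  obtain p where p: "p \<in> P" using P by fastforce
  show "wins P L {} {}"
  proof (rule wins.step[of p])
    show "p \<in> P - ({} \<union> {})" using p by simp
    show "P \<noteq> insert p ({} \<union> {})" using P by auto
    fix q assume "q \<in> P - insert p ({} \<union> {})"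
    then have q: "q \<in> P" "p \<noteq> q" by auto
    \<comment> \<open>The coordinates are fitted to the reply: a different \<open>f\<close> may be
      used for each \<open>q\<close>, so one explicit tree covers all replies.\<close>
    obtain f :: "nat \<Rightarrow> 'a" where f: "bij_betw f {..<16} P" "f 0 = p" "f 1 = q" "L = (`) f ` plane4"
      using affine_plane_4_coordinates[OF assms p q] by blast
    have "\<Union> plane4 \<subseteq> {..<16}" using plane4_subset unfolding plane4_def by auto
    then have "wins P L {p} {q}"
      using wins_image[OF wins_plane4, of f] f unfolding bij_betw_def by auto
    moreover have "\<not> occupies_line L {q}"
    proof
      assume "occupies_line L {q}"
      then obtain l where "l \<in> L" "l \<subseteq> {q}" unfolding occupies_line_def by blast
      then show False using lines[of l] card_mono[of "{q}" l] by simp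
    qed
    ultimately show "\<not> occupies_line L (insert q {}) \<and> wins P L (insert p {}) (insert q {})" by simp
  qed
qed

end
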